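(* Let $p>3$ be a prime. Then $$\sum_{k=0}^{p-1}\frac{\binom{2k}{k}}{12^k}T_k\equiv\left(\frac{p}{3}\right)\frac{3^{p-1}+3}{4}\pmod{p^2}.$$
   Context: For $n\in\{0,1,2,\ldots\}$, $T_n$ denotes the $n$th central trinomial coefficient, i.e. the coefficient of $x^n$ in the expansion of $(1+x+x^2)^n$; equivalently $T_n=\sum_{k=0}^{\lfloor n/2\rfloor}\binom{n}{2k}\binom{2k}{k}$. $\left(\frac{\cdot}{p}\right)$ denotes the Legendre symbol. For rational numbers $a,b$ whose denominators are prime to $p$, $a\equiv b\pmod{p^2}$ means that $(a-b)/p^2$ is a rational number with denominator prime to $p$. *)

theory Defs
  imports "HOL-Number_Theory.Number_Theory" "HOL-Computational_Algebra.Polynomial"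
begin

definition central_trinomial :: "nat \<Rightarrow> nat" where
  "central_trinomial n = poly.coeff ([:1, 1, 1:] ^ n) n"

(* quotient_of gives the reduced fraction with positive denominator. *)
definition p_integral :: "nat \<Rightarrow> rat \<Rightarrow> bool" where
  "p_integral p r \<longleftrightarrow> coprime (snd (quotient_of r)) (int p)"

definition rat_cong_sq :: "nat \<Rightarrow> rat \<Rightarrow> rat \<Rightarrow> bool" where
  "rat_cong_sq p a b \<longleftrightarrow>
     p_integral p a \<and> p_integral p b \<and> p_integral p ((a - b) / of_nat (p ^ 2))"

end

theory Submission
  imports Defs
begin

text \<open>
  Writing $1 + x + x^2 = 3x + (1-x)^2$ gives
  $T_k = \<Sum>_j (-1)^j 3^{k-j} {k \choose j} {2j \choose j}$. After exchanging the order of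
  summation, the inner sum over $k$ has a closed form, so that the sum in question is
  $2 \cdot 4^{-p} {2p \choose p} \<Sum>_{j<p} p\,(-1/3)^j {2j \choose j} {p-1 \choose j} / (2j+1)$.
  Put $h = (p-1)/2$. The term $j = h$, where $p$ cancels, is needed modulo $p^2$, the terms $j > h$
  vanish modulo $p^2$, and the terms $j < h$, needed only up to multiples of $p^2$, reduce by
  ${2j \choose j} \<equiv> (-4)^j {h \choose j}$ to truncated logarithms $\<Sum>_{k \<le> h} x^{2k}/k$ at
  $x = 1$ and $x = 1/2$. These are Fermat quotients of 2 and 3, because
  $p \<Sum>_{0<k<p} x^k/k \<equiv> 1 - x^p - (1-x)^p$ modulo $p^2$. The quotients of 2 cancel, and the
  Legendre symbol comes from $(-3)^h$.
\<close>

section \<open>Binomial identities over the rationals\<close>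

lemma central_trinomial_eq_sum:
  "(of_nat (central_trinomial k) :: rat) =
     (\<Sum>j\<le>k. of_nat (k choose j) * of_nat ((2 * j) choose j) * (-1) ^ j * 3 ^ (k - j))"
proof -
  have split: "[:1, 1, 1::int:] = [:1, -1:] ^ 2 + [:0, 3:]"
    by (simp add: power2_eq_square)
  have lin: "[:1, -1::int:] ^ m = (\<Sum>i\<le>m. monom ((-1) ^ i * int (m choose i)) i)" for m
  proof -
    have "[:1, -1::int:] ^ m = ([:0, -1:] + 1) ^ m"
      by (simp add: one_pCons)
    also have "\<dots> = (\<Sum>i\<le>m. of_nat (m choose i) * [:0, -1:] ^ i)"
      by (simp add: binomial_ring)
    also have "\<dots> = (\<Sum>i\<le>m. monom ((-1) ^ i * int (m choose i)) i)"
    proof (rule sum.cong)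
      fix i
      have "[:0, -1::int:] = monom (-1) 1" by (simp add: monom_altdef)
      then show "of_nat (m choose i) * [:0, -1::int:] ^ i = monom ((-1) ^ i * int (m choose i)) i"
        by (simp add: monom_power of_nat_poly smult_monom mult.commute)
    qed simp
    finally show ?thesis .
  qed
  have coeff_lin: "poly.coeff ([:1, -1::int:] ^ m) i = (-1) ^ i * int (m choose i)" for m i
    by (cases "i \<le> m") (simp_all add: lin coeff_sum binomial_eq_0)
  \<comment> \<open>The definition uses polynomials over the naturals, where 1 - x does not exist,
    so the power is first moved to integer coefficients.\<close>
  have cast: "int (poly.coeff (q::nat poly) i) = poly.coeff (map_poly int q) i" for q i
    by (simp add: coeff_map_poly)
  have pow: "map_poly int ([:1, 1, 1:] ^ k) = [:1, 1, 1:] ^ k"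
  proof (induction k)
    case (Suc k)
    have "map_poly int (q * r) = map_poly int q * map_poly int r" for q r
      by (intro poly_eqI) (simp add: coeff_map_poly coeff_mult)
    then show ?case by (simp only: power_Suc Suc) (simp add: map_poly_pCons)
  qed (simp add: map_poly_pCons one_pCons)
  have "int (central_trinomial k) = poly.coeff (([:1, -1:] ^ 2 + [:0, 3:]) ^ k) k"
    unfolding central_trinomial_def cast pow split ..
  also have "\<dots> = (\<Sum>j\<le>k. poly.coeff (of_nat (k choose j) * ([:1, -1:] ^ 2) ^ j * [:0, 3:] ^ (k - j)) k)"
    by (simp only: binomial_ring coeff_sum)
  also have "\<dots> = (\<Sum>j\<le>k. int (k choose j) * int ((2 * j) choose j) * (-1) ^ j * 3 ^ (k - j))"
  proof (rule sum.cong)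
    fix j assume "j \<in> {..k}"
    then have j: "j \<le> k" by simp
    \<comment> \<open>The factor (3x)^(k-j) shifts degrees by k - j. What remains is the coefficient
      of x^j in (1-x)^(2j), the central one, which is where \<open>(2 * j) choose j\<close> comes
      from.\<close>
    have "[:0, 3::int:] = monom 3 1" by (simp add: monom_altdef)
    moreover have "([:1, -1::int:] ^ 2) ^ j = [:1, -1:] ^ (2 * j)" by (simp only: power_mult)
    ultimately have "of_nat (k choose j) * ([:1, -1:] ^ 2) ^ j * [:0, 3::int:] ^ (k - j)
        = monom (int (k choose j) * 3 ^ (k - j)) (k - j) * [:1, -1:] ^ (2 * j)"
      by (simp add: monom_power of_nat_poly mult_ac flip: smult_monom)
    then show "poly.coeff (of_nat (k choose j) * ([:1, -1:] ^ 2) ^ j * [:0, 3::int:] ^ (k - j)) k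
        = int (k choose j) * int ((2 * j) choose j) * (-1) ^ j * 3 ^ (k - j)"
      using j by (simp add: coeff_monom_mult coeff_lin del: power_Suc)
  qed simp
  finally have "(of_int (int (central_trinomial k)) :: rat) = of_int \<dots>" by (rule arg_cong)
  then show ?thesis by simp
qed

lemma central_binomial_Suc:
  "(of_nat (Suc n) :: rat) * of_nat ((2 * Suc n) choose Suc n) =
     2 * (2 * of_nat n + 1) * of_nat ((2 * n) choose n)"
proof -
  have "Suc n * ((2 * Suc n) choose Suc n) = (2 * Suc n) * ((2 * n + 1) choose n)"
    using binomial_absorption[of n "2 * Suc n"] by simp
  moreover have "Suc n * ((2 * n + 1) choose n) = (2 * n + 1) * ((2 * n) choose n)"
    using binomial_absorb_comp[of "2 * n + 1" n] by simp
  \<comment> \<open>One extra factor \<open>Suc n\<close> lets the two absorption identities be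
    chained; it is cancelled afterwards.\<close>
  ultimately have "Suc n * (Suc n * ((2 * Suc n) choose Suc n))
      = (2 * Suc n) * ((2 * n + 1) * ((2 * n) choose n))"
    by (metis mult.left_commute)
  also have "\<dots> = Suc n * (2 * (2 * n + 1) * ((2 * n) choose n))" by (simp only: mult_ac)
  finally have "Suc n * ((2 * Suc n) choose Suc n) = 2 * (2 * n + 1) * ((2 * n) choose n)"
    by (simp only: mult_cancel1) simp
  then have "(of_nat (Suc n * ((2 * Suc n) choose Suc n)) :: rat)
      = of_nat (2 * (2 * n + 1) * ((2 * n) choose n))" by (rule arg_cong)
  then show ?thesis by (simp only: of_nat_mult of_nat_add of_nat_numeral of_nat_1)
qed

text \<open>This evaluates the inner sum left by exchanging the order of summation. The right-hand
  side telescopes in \<open>n\<close>: its increment is 2j+1 times the new summand.\<close>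

lemma sum_central_binomial_choose:
  "(2 * of_nat j + 1) * (\<Sum>k<n. of_nat ((2 * k) choose k) * of_nat (k choose j) / 4 ^ k) =
     (2 * of_nat (Suc j) * of_nat (n choose Suc j) * of_nat ((2 * n) choose n) / 4 ^ n :: rat)"
proof (induction n)
  case (Suc n)
  let ?c = "of_nat ((2 * n) choose n) / 4 ^ n :: rat"
  have a: "(of_nat (Suc j) :: rat) * of_nat (n choose Suc j) = (of_nat n - of_nat j) * of_nat (n choose j)"
  proof (cases "j \<le> n")
    case True
    have "Suc j * (n choose Suc j) = (n - j) * (n choose j)"
      by (simp only: binomial_absorption binomial_absorb_comp)
    then have "(of_nat (Suc j * (n choose Suc j)) :: rat) = of_nat ((n - j) * (n choose j))"
      by (rule arg_cong)
    then show ?thesis using True by (simp only: of_nat_mult of_nat_diff)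
  qed (simp add: binomial_eq_0)
  have b: "(of_nat (Suc j) :: rat) * of_nat (Suc n choose Suc j) = of_nat (Suc n) * of_nat (n choose j)"
    using Suc_times_binomial[of j n] by (simp only: flip: of_nat_mult)
  have "2 * of_nat (Suc j) * of_nat (Suc n choose Suc j) * of_nat ((2 * Suc n) choose Suc n) / 4 ^ Suc n
     = 2 * of_nat (n choose j) * (of_nat (Suc n) * of_nat ((2 * Suc n) choose Suc n)) / (4 ^ Suc n :: rat)"
    using b by (simp only: mult.assoc) (simp only: mult_ac)
  also have "\<dots> = (2 * of_nat n + 1) * of_nat (n choose j) * ?c"
    unfolding central_binomial_Suc by (simp add: field_simps)
  \<comment> \<open>Split 2n+1 = 2(n-j) + (2j+1). By \<open>a\<close> the first part is the
    right-hand side for \<open>n\<close>, and the second is the new summand times 2j+1.\<close>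
  also have "\<dots> = 2 * (of_nat (Suc j) * of_nat (n choose Suc j)) * ?c + (2 * of_nat j + 1) * of_nat (n choose j) * ?c"
    unfolding a by (simp add: field_simps)
  finally show ?case
    unfolding sum.lessThan_Suc distrib_left Suc.IH by (simp only: mult_ac times_divide_eq_right)
qed simp

text \<open>Both sides are the integral of ((1+t)^h - 1)/t from 0 to x. The induction avoids
  calculus: by Pascal's rule, raising \<open>h\<close> by one adds ((1+x)^(h+1) - 1)/(h+1). This
  later turns a binomial sum into truncated logarithms.\<close>

lemma sum_binomial_div_index:
  "(\<Sum>j=1..h. of_nat (h choose j) * x ^ j / of_nat j) = (\<Sum>k=1..h. ((1 + x) ^ k - 1) / of_nat k)"
  for x :: rat
proof (induction h)
  case (Suc h)
  have "(\<Sum>j=1..Suc h. of_nat (Suc h choose j) * x ^ j / of_nat j)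
     = (\<Sum>j=1..Suc h. of_nat (h choose j) * x ^ j / of_nat j + of_nat (h choose (j - 1)) * x ^ j / of_nat j)"
    by (intro sum.cong refl) (auto simp: field_simps choose_reduce_nat)
  also have "\<dots> = (\<Sum>j=1..h. of_nat (h choose j) * x ^ j / of_nat j) + (\<Sum>j=1..Suc h. of_nat (h choose (j - 1)) * x ^ j / of_nat j)"
    by (simp add: sum.distrib)
  \<comment> \<open>Absorption trades the denominator j for the constant h + 1, leaving a full
    binomial expansion without its constant term.\<close>
  also have "(\<Sum>j=1..Suc h. of_nat (h choose (j - 1)) * x ^ j / of_nat j)
      = (\<Sum>j=1..Suc h. of_nat (Suc h choose j) * x ^ j / of_nat (Suc h))"
  proof (rule sum.cong)
    fix j assume "j \<in> {1..Suc h}"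
    then have "j * (Suc h choose j) = Suc h * (h choose (j - 1))" "j \<noteq> 0"
      by (auto simp: times_binomial_minus1_eq)
    then have "(of_nat j * of_nat (Suc h choose j) :: rat) = of_nat (Suc h) * of_nat (h choose (j - 1))"
      by (simp only: flip: of_nat_mult)
    then show "of_nat (h choose (j - 1)) * x ^ j / of_nat j = of_nat (Suc h choose j) * x ^ j / of_nat (Suc h)"
      using \<open>j \<noteq> 0\<close> by (simp add: field_simps del: of_nat_Suc)
  qed simp
  also have "\<dots> = ((\<Sum>j\<le>Suc h. of_nat (Suc h choose j) * x ^ j) - 1) / of_nat (Suc h)"
    by (simp only: sum_divide_distrib atMost_atLeast0 sum.atLeast_Suc_atMost[of 0 "Suc h"])
       (simp add: sum_divide_distrib add_divide_distrib)
  also have "(\<Sum>j\<le>Suc h. of_nat (Suc h choose j) * x ^ j) = (1 + x) ^ Suc h"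
    by (simp add: binomial_ring[of x 1] add.commute[of 1 x] del: power_Suc)
  finally show ?case using Suc by (simp del: power_Suc)
qed simp

section \<open>Rationals integral at p and congruences modulo p^n\<close>

text \<open>The rationals $p^n a/b$ with $p$ prime to $b$; for $n = 0$ these are the $p$-integral ones.\<close>
definition p_multiples :: "nat \<Rightarrow> nat \<Rightarrow> rat set" where
  "p_multiples p n = {of_nat p ^ n * (of_int a / of_int b) | a b. coprime b (int p)}"

locale prime_localization =
  fixes p :: nat
  assumes prime_p: "prime p"
begin

abbreviation I :: "nat \<Rightarrow> rat set" where "I \<equiv> p_multiples p"

lemma I_I: "coprime b (int p) \<Longrightarrow> x = of_nat p ^ n * (of_int a / of_int b) \<Longrightarrow> x \<in> I n"
  unfolding p_multiples_def by blast

lemma coprime_p_nonzero: "coprime b (int p) \<Longrightarrow> b \<noteq> 0"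
  using prime_p by (auto simp: prime_nat_iff)

lemma I_E:
  assumes "x \<in> I n"
  obtains a b where "coprime b (int p)" "b \<noteq> 0" "x = of_nat p ^ n * (of_int a / of_int b)"
  using assms coprime_p_nonzero unfolding p_multiples_def by blast

lemma p_integral_iff: "p_integral p x \<longleftrightarrow> x \<in> I 0"
proof
  assume *: "p_integral p x"
  obtain a b where ab: "quotient_of x = (a, b)" by (cases "quotient_of x")
  then show "x \<in> I 0"
    using * by (intro I_I[of b _ _ a]) (simp_all add: p_integral_def quotient_of_div)
next
  assume "x \<in> I 0"
  then obtain a b where b: "coprime b (int p)" "b \<noteq> 0" and "x = of_nat p ^ 0 * (of_int a / of_int b)"
    by (rule I_E)
  then have x: "x = of_int a / of_int b" by simp
  obtain c d where cd: "quotient_of x = (c, d)" by (cases "quotient_of x")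
  have "d > 0" "coprime c d" "x = of_int c / of_int d"
    using cd by (simp_all add: quotient_of_denom_pos quotient_of_coprime quotient_of_div)
  \<comment> \<open>Cross-multiplication shows that the reduced denominator \<open>d\<close> divides
    \<open>b\<close>, hence is prime to p as well.\<close>
  then have "of_int (c * b) = (of_int (a * d) :: rat)" using x b by (simp add: field_simps)
  then have "c * b = a * d" by (simp only: of_int_eq_iff)
  then have "d dvd c * b" by simp
  then have "d dvd b" using \<open>coprime c d\<close>
    by (simp add: coprime_dvd_mult_right_iff coprime_commute)
  then show "p_integral p x" using coprime_divisors[of d b "int p" "int p"] b cd by (simp add: p_integral_def)
qed

lemma I_of_int [simp]: "of_int a \<in> I 0"
  by (rule I_I[of 1 _ _ a]) simp_all

lemma I_of_nat [simp]: "of_nat a \<in> I 0"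
  using I_of_int[of "int a"] by simp

lemma I_numeral [simp]: "0 \<in> I 0" "1 \<in> I 0" "numeral k \<in> I 0" "- numeral k \<in> I 0"
  using I_of_int[of 0] I_of_int[of 1] I_of_int[of "numeral k"] I_of_int[of "- numeral k"]
  by simp_all

lemma I_0 [simp]: "0 \<in> I n"
  by (rule I_I[of 1 _ _ 0]) simp_all

lemma I_add: "x \<in> I n \<Longrightarrow> y \<in> I n \<Longrightarrow> x + y \<in> I n"
proof (elim I_E)
  fix a b c d :: int
  assume "coprime b (int p)" "coprime d (int p)" "b \<noteq> 0" "d \<noteq> 0"
    "x = of_nat p ^ n * (of_int a / of_int b)" "y = of_nat p ^ n * (of_int c / of_int d)"
  then show ?thesis by (intro I_I[of "b * d" _ _ "a * d + c * b"]) (simp_all add: field_simps)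
qed

lemma I_uminus: "x \<in> I n \<Longrightarrow> - x \<in> I n"
proof (elim I_E)
  fix a b :: int
  assume "coprime b (int p)" "x = of_nat p ^ n * (of_int a / of_int b)"
  then show ?thesis by (intro I_I[of b _ _ "- a"]) simp_all
qed

lemma I_diff: "x \<in> I n \<Longrightarrow> y \<in> I n \<Longrightarrow> x - y \<in> I n"
  using I_add[of x n "- y"] I_uminus by simp

lemma I_mult_add: "x \<in> I m \<Longrightarrow> y \<in> I n \<Longrightarrow> x * y \<in> I (m + n)"
proof (elim I_E)
  fix a b c d :: int
  assume "coprime b (int p)" "coprime d (int p)"
    "x = of_nat p ^ m * (of_int a / of_int b)" "y = of_nat p ^ n * (of_int c / of_int d)"
  then show ?thesis by (intro I_I[of "b * d" _ _ "a * c"]) (simp_all add: power_add)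
qed

lemma I_mult: "x \<in> I 0 \<Longrightarrow> y \<in> I n \<Longrightarrow> x * y \<in> I n"
  using I_mult_add[of x 0 y n] by simp

lemma I_mult_right: "x \<in> I n \<Longrightarrow> y \<in> I 0 \<Longrightarrow> x * y \<in> I n"
  using I_mult_add[of x n y 0] by simp

lemma I_mult_1: "x \<in> I 1 \<Longrightarrow> y \<in> I 1 \<Longrightarrow> x * y \<in> I 2"
  using I_mult_add[of x 1 y 1] by (simp add: numeral_2_eq_2)

lemma I_power: "x \<in> I 0 \<Longrightarrow> x ^ k \<in> I 0"
  by (induction k) (simp_all add: I_mult)

lemma I_sum: "(\<And>i. i \<in> A \<Longrightarrow> f i \<in> I n) \<Longrightarrow> sum f A \<in> I n"
  by (induction A rule: infinite_finite_induct) (simp_all add: I_add)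

lemma I_p: "of_nat p \<in> I 1"
  by (rule I_I[of 1 _ _ 1]) simp_all

lemma I_p_mult: "x \<in> I n \<Longrightarrow> of_nat p * x \<in> I (Suc n)"
  using I_mult_add[OF I_p] by simp

lemma I_mono: "x \<in> I n \<Longrightarrow> m \<le> n \<Longrightarrow> x \<in> I m"
proof (elim I_E)
  fix a b :: int
  assume "m \<le> n" "coprime b (int p)" "x = of_nat p ^ n * (of_int a / of_int b)"
  then show ?thesis
    by (intro I_I[of b _ _ "int p ^ (n - m) * a"]) (simp_all flip: power_add mult.assoc)
qed

lemma I_inverse: "coprime b p \<Longrightarrow> 1 / of_nat b \<in> I 0"
  by (rule I_I[of "int b" _ _ 1]) simp_all

lemma I_divide: "x \<in> I n \<Longrightarrow> coprime b p \<Longrightarrow> x / of_nat b \<in> I n"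
  using I_mult_right[OF _ I_inverse] by simp

lemma coprime_less: "0 < b \<Longrightarrow> b < p \<Longrightarrow> coprime b p"
  by (metis coprime_commute nat_dvd_not_less prime_imp_coprime prime_p)

lemma I_of_nat_dvd: "p dvd a \<Longrightarrow> of_nat a \<in> I 1"
  using I_p_mult[of _ 0] by (auto elim!: dvdE)

lemma I_of_int_dvd: "int p dvd a \<Longrightarrow> of_int a \<in> I 1"
  using I_p_mult[of _ 0] by (auto elim!: dvdE)

text \<open>Only the difference is constrained, so sums and differences of congruences carry no side
  conditions. Integrality enters with products, and \<open>qcong_integral\<close> passes it from one
  side of a congruence to the other.\<close>

definition qcong :: "nat \<Rightarrow> rat \<Rightarrow> rat \<Rightarrow> bool" where
  "qcong n x y \<longleftrightarrow> x - y \<in> I n"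

lemma qcong_refl [simp, intro]: "qcong n x x"
  by (simp add: qcong_def)

lemma qcong_sym: "qcong n x y \<Longrightarrow> qcong n y x"
  using I_uminus[of "x - y" n] by (simp add: qcong_def)

lemma qcong_trans [trans]: "qcong n x y \<Longrightarrow> qcong n y z \<Longrightarrow> qcong n x z"
  using I_add[of "x - y" n "y - z"] by (simp add: qcong_def)

lemma qcong_add: "qcong n x y \<Longrightarrow> qcong n u v \<Longrightarrow> qcong n (x + u) (y + v)"
  using I_add[of "x - y" n "u - v"] by (simp add: qcong_def algebra_simps)

lemma qcong_uminus: "qcong n x y \<Longrightarrow> qcong n (- x) (- y)"
  using I_uminus[of "x - y" n] by (simp add: qcong_def)

lemma qcong_diff: "qcong n x y \<Longrightarrow> qcong n u v \<Longrightarrow> qcong n (x - u) (y - v)"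
  using qcong_add[OF _ qcong_uminus] by simp

lemma qcong_integral:
  assumes "qcong n x y" "x \<in> I 0"
  shows "y \<in> I 0"
proof -
  have "x - y \<in> I 0" using assms(1) by (auto simp: qcong_def intro: I_mono)
  then have "x - (x - y) \<in> I 0" by (rule I_diff[OF assms(2)])
  then show ?thesis by simp
qed

lemma qcong_mult:
  assumes "qcong n x y" "qcong n u v" "x \<in> I 0" "u \<in> I 0"
  shows "qcong n (x * u) (y * v)"
proof -
  have "(x - y) * u \<in> I n" "y * (u - v) \<in> I n"
    using assms qcong_integral[of n x y] by (auto intro: I_mult I_mult_right simp: qcong_def)
  then have "(x - y) * u + y * (u - v) \<in> I n" by (rule I_add)
  then show ?thesis by (simp add: qcong_def algebra_simps)
qed

lemma qcong_scale: "qcong n x y \<Longrightarrow> c \<in> I 0 \<Longrightarrow> qcong n (c * x) (c * y)"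
  using I_mult[of c "x - y" n] by (simp add: qcong_def algebra_simps)

lemma qcong_p_mult: "qcong n x y \<Longrightarrow> qcong (Suc n) (of_nat p * x) (of_nat p * y)"
  using I_p_mult[of "x - y" n] by (simp add: qcong_def algebra_simps)

lemma qcong_sum: "(\<And>i. i \<in> A \<Longrightarrow> qcong n (f i) (g i)) \<Longrightarrow> qcong n (sum f A) (sum g A)"
  using I_sum[of A "\<lambda>i. f i - g i" n] by (simp add: qcong_def sum_subtractf)

lemma qcong_mult_cancel:
  assumes "qcong n (of_nat b * x) (of_nat b * y)" "coprime b p"
  shows "qcong n x y"
proof -
  have "b \<noteq> 0" using assms(2) prime_p by (cases "b = 0") auto
  have "(of_nat b * x - of_nat b * y) / of_nat b \<in> I n"
    using assms by (intro I_divide) (simp_all add: qcong_def)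
  then show ?thesis using \<open>b \<noteq> 0\<close> by (simp add: qcong_def flip: right_diff_distrib)
qed

lemma qcong_divide: "qcong n x y \<Longrightarrow> coprime b p \<Longrightarrow> qcong n (x / of_nat b) (y / of_nat b)"
  using qcong_scale[OF _ I_inverse] by simp

lemma qcong_of_int: "[a = b] (mod int p) \<Longrightarrow> qcong 1 (of_int a) (of_int b)"
  using I_of_int_dvd[of "a - b"] by (simp add: qcong_def cong_iff_dvd_diff)

section \<open>Binomial coefficients modulo p and p^2\<close>

text \<open>By Pascal's rule two neighbours in row p-1 add up to an inner entry of row p, which p
  divides; so the entries alternate in sign modulo p, starting from 1.\<close>

lemma qcong_prime_choose:
  assumes "j < p"
  shows "qcong 1 (of_nat ((p - 1) choose j)) ((-1) ^ j)"
  using assms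
proof (induction j)
  case (Suc j)
  have "(p choose Suc j) = ((p - 1) choose j) + ((p - 1) choose Suc j)"
    using Suc.prems by (simp add: choose_reduce_nat)
  moreover have "p dvd (p choose Suc j)"
    using Suc.prems prime_p by (intro dvd_choose_prime) auto
  ultimately have "of_nat ((p - 1) choose j) + of_nat ((p - 1) choose Suc j) \<in> I 1"
    using I_of_nat_dvd by (metis of_nat_add)
  then have "qcong 1 (of_nat ((p - 1) choose Suc j)) (- of_nat ((p - 1) choose j))"
    by (simp add: qcong_def add.commute)
  also have "qcong 1 \<dots> (- ((-1) ^ j))"
    using Suc by (intro qcong_uminus) simp
  finally show ?case by simp
qed simp

text \<open>The same recursion along row p-1, but the entry of row p is now kept as p/(j+1) times an
  entry of row p-1. That entry is needed modulo p only, so the first-order congruence suffices, and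
  the reciprocals 1/(j+1) accumulate to a harmonic number.\<close>

lemma qcong_prime_choose_2:
  assumes "j < p"
  shows "qcong 2 (of_nat ((p - 1) choose j)) ((-1) ^ j * (1 - of_nat p * (\<Sum>i=1..j. 1 / of_nat i)))"
  using assms
proof (induction j)
  case (Suc j)
  have "Suc j * (p choose Suc j) = p * ((p - 1) choose j)"
    by (rule binomial_absorption)
  then have "(of_nat (Suc j) :: rat) * of_nat (p choose Suc j) = of_nat p * of_nat ((p - 1) choose j)"
    by (simp only: flip: of_nat_mult)
  then have pc: "(of_nat (p choose Suc j) :: rat) = of_nat p * (of_nat ((p - 1) choose j) / of_nat (Suc j))"
    by (simp add: field_simps del: of_nat_Suc)
  have "(p choose Suc j) = ((p - 1) choose j) + ((p - 1) choose Suc j)"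
    using Suc.prems by (simp add: choose_reduce_nat)
  then have "(of_nat ((p - 1) choose Suc j) :: rat) = of_nat (p choose Suc j) - of_nat ((p - 1) choose j)"
    by simp
  also have "qcong 2 \<dots> (of_nat p * ((-1) ^ j / of_nat (Suc j)) -
      (-1) ^ j * (1 - of_nat p * (\<Sum>i=1..j. 1 / of_nat i)))"
    unfolding pc
  proof (rule qcong_diff)
    have "qcong 1 (of_nat ((p - 1) choose j) / of_nat (Suc j)) ((-1) ^ j / of_nat (Suc j))"
      using Suc.prems by (intro qcong_divide qcong_prime_choose coprime_less) auto
    from qcong_p_mult[OF this]
    show "qcong 2 (of_nat p * (of_nat ((p - 1) choose j) / of_nat (Suc j)))
        (of_nat p * ((-1) ^ j / of_nat (Suc j)))" by (simp add: numeral_2_eq_2)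
  qed (use Suc in simp)
  also have "of_nat p * ((-1) ^ j / of_nat (Suc j)) -
      (-1) ^ j * (1 - of_nat p * (\<Sum>i=1..j. 1 / of_nat i)) =
      ((-1) ^ Suc j * (1 - of_nat p * (\<Sum>i=1..Suc j. 1 / of_nat i)) :: rat)"
    by (simp add: algebra_simps)
  finally show ?case .
qed simp

text \<open>In Vandermonde's sum of the squares of row p, the two end terms are 1 and every other
  term is the square of a multiple of p.\<close>

lemma central_binomial_prime: "qcong 2 (of_nat ((2 * p) choose p)) 2"
proof -
  have "(2 * p choose p) = (\<Sum>k\<le>p. (p choose k)\<^sup>2)"
    by (simp add: choose_square_sum)
  also have "\<dots> = 2 + (\<Sum>k=1..p-1. (p choose k)\<^sup>2)"
  proof -
    have "p > 0" using prime_p by (simp add: prime_gt_0_nat)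
    then obtain m where m: "p = Suc m" by (cases p) auto
    show ?thesis
      by (simp only: atMost_atLeast0 m sum.atLeast_Suc_atMost[of 0] le0) simp
  qed
  finally have "(of_nat ((2 * p) choose p) :: rat) - 2 = (\<Sum>k=1..p-1. of_nat (p choose k) * of_nat (p choose k))"
    by (simp add: power2_eq_square)
  also have "\<dots> \<in> I 2"
    using prime_p by (intro I_sum I_mult_1 I_of_nat_dvd dvd_choose_prime) (auto simp: prime_gt_0_nat)
  finally show ?thesis by (simp add: qcong_def)
qed

text \<open>Over the rationals the central binomial coefficient is (-4)^j times the generalized
  binomial coefficient of -1/2 over j, and h is congruent to -1/2 modulo p. The induction compares
  the two recurrences.\<close>

lemma central_binomial_qcong:
  assumes "p = 2 * h + 1" "j \<le> h"
  shows "qcong 1 (of_nat ((2 * j) choose j)) ((-4) ^ j * of_nat (h choose j))"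
  using assms(2)
proof (induction j)
  case (Suc j)
  have absorb: "(of_nat (Suc j) :: rat) * of_nat (h choose Suc j) = (of_nat h - of_nat j) * of_nat (h choose j)"
  proof -
    have "Suc j * (h choose Suc j) = (h - j) * (h choose j)"
      by (simp only: binomial_absorption binomial_absorb_comp)
    then have "(of_nat (Suc j * (h choose Suc j)) :: rat) = of_nat ((h - j) * (h choose j))"
      by (rule arg_cong)
    then show ?thesis using Suc.prems by (simp only: of_nat_mult of_nat_diff)
  qed
  show ?case
  proof (rule qcong_mult_cancel)
    have "of_nat (Suc j) * of_nat ((2 * Suc j) choose Suc j) = (2 * (2 * of_nat j + 1)) * (of_nat ((2 * j) choose j) :: rat)"
      by (rule central_binomial_Suc)
    also have "qcong 1 \<dots> ((2 * (2 * of_nat j + 1)) * ((-4) ^ j * of_nat (h choose j)))"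
      using Suc by (intro qcong_scale) (simp_all add: I_mult I_add)
    \<comment> \<open>Subtracting 2p turns 2(2j+1) into -4(h-j), the ratio that occurs in the
      recurrence of the other side.\<close>
    also have "qcong 1 \<dots> (((2 * (2 * of_nat j + 1)) - 2 * of_nat p) * ((-4) ^ j * of_nat (h choose j)))"
    proof -
      have "of_nat p * (2 * ((-4) ^ j * of_nat (h choose j))) \<in> I 1"
        by (intro I_mult_right[OF I_p] I_mult I_power) simp_all
      then show ?thesis by (simp add: qcong_def algebra_simps)
    qed
    also have "(((2 * (2 * of_nat j + 1)) - 2 * of_nat p) * ((-4) ^ j * of_nat (h choose j)))
      = (-4) ^ Suc j * ((of_nat h - of_nat j) * of_nat (h choose j) :: rat)"
      by (simp add: assms(1) algebra_simps)
    also have "\<dots> = of_nat (Suc j) * ((-4) ^ Suc j * of_nat (h choose Suc j))"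
      unfolding absorb[symmetric] by (simp only: mult_ac)
    finally show "qcong 1 (of_nat (Suc j) * of_nat (2 * Suc j choose Suc j))
      (of_nat (Suc j) * ((-4) ^ Suc j * of_nat (h choose Suc j)))" .
  qed (use Suc.prems assms(1) in \<open>intro coprime_less, auto\<close>)
qed simp

section \<open>Truncated logarithms modulo p^2\<close>

text \<open>Expand (1-x)^p. The inner coefficient at k is p/k times an entry of row p-1, hence
  congruent to (-1)^(k-1) p/k modulo p^2. The sum on the left is the series of -log(1-x) cut off
  before x^p.\<close>

lemma qcong_truncated_log:
  assumes "odd p" "x \<in> I 0"
  shows "qcong 2 (of_nat p * (\<Sum>k=1..p-1. x ^ k / of_nat k)) (1 - x ^ p - (1 - x) ^ p)"
proof -
  obtain m where m: "p = Suc m" using prime_p prime_gt_0_nat by (cases p) auto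
  have "(1 - x) ^ p = (\<Sum>k\<le>p. of_nat (p choose k) * (- x) ^ k)"
    using binomial_ring[of "- x" 1 p] by simp
  also have "\<dots> = 1 - x ^ p + (\<Sum>k=1..p-1. of_nat (p choose k) * (- x) ^ k)"
    using assms(1) unfolding m
    by (simp only: atMost_atLeast0 sum.atLeast_Suc_atMost[of 0] le0) simp
  finally have "1 - x ^ p - (1 - x) ^ p = (\<Sum>k=1..p-1. - (of_nat (p choose k) * (- x) ^ k))"
    by (simp add: sum_negf)
  moreover have "qcong 2 (\<Sum>k=1..p-1. of_nat p * (x ^ k / of_nat k)) (\<Sum>k=1..p-1. - (of_nat (p choose k) * (- x) ^ k))"
  proof (rule qcong_sum)
    fix k assume k: "k \<in> {1..p-1}"
    then obtain j where j: "k = Suc j" by (cases k) auto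
    have "Suc j * (p choose Suc j) = p * ((p - 1) choose j)"
      by (rule binomial_absorption)
    then have "(of_nat (Suc j) :: rat) * of_nat (p choose Suc j) = of_nat p * of_nat ((p - 1) choose j)"
      by (simp only: flip: of_nat_mult)
    then have "(of_nat (p choose k) :: rat) = of_nat p * (of_nat ((p - 1) choose j) / of_nat (Suc j))"
      by (simp add: j field_simps del: of_nat_Suc)
    then have "- (of_nat (p choose k) * (- x) ^ k) = of_nat p * (((- ((- x) ^ k)) * of_nat ((p - 1) choose j)) / of_nat k)"
      by (simp add: j)
    also have "qcong (Suc 1) \<dots> (of_nat p * (((- ((- x) ^ k)) * (-1) ^ j) / of_nat k))"
      using k assms(2) j
      by (intro qcong_p_mult qcong_divide qcong_scale qcong_prime_choose coprime_less I_uminus I_power) auto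
    also have "(- ((- x) ^ k)) * (-1) ^ j = x ^ k"
      by (simp add: j power_minus[of x])
    finally show "qcong 2 (of_nat p * (x ^ k / of_nat k)) (- (of_nat (p choose k) * (- x) ^ k))"
      by (auto intro: qcong_sym simp: numeral_2_eq_2)
  qed
  ultimately show ?thesis by (simp only: sum_distrib_left)
qed

text \<open>Add the previous congruence at x and at -x. Odd powers cancel, and the exponent 2k
  contributes 2 x^(2k)/(2k).\<close>

lemma qcong_truncated_log_squares:
  assumes "p = 2 * h + 1" "x \<in> I 0"
  shows "qcong 2 (of_nat p * (\<Sum>k=1..h. (x ^ 2) ^ k / of_nat k)) (2 - (1 - x) ^ p - (1 + x) ^ p)"
proof -
  have even_terms: "(\<Sum>k=1..2*h. x ^ k / of_nat k + (- x) ^ k / of_nat k) = (\<Sum>k=1..h. (x ^ 2) ^ k / of_nat k)" for h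
    by (induction h) (simp_all add: power_mult[symmetric] field_simps)
  have "of_nat p * (\<Sum>k=1..h. (x ^ 2) ^ k / of_nat k) =
     of_nat p * (\<Sum>k=1..p-1. x ^ k / of_nat k) + of_nat p * (\<Sum>k=1..p-1. (-x) ^ k / of_nat k)"
    unfolding even_terms[symmetric] by (simp add: assms(1) sum.distrib distrib_left)
  also have "qcong 2 \<dots> ((1 - x ^ p - (1 - x) ^ p) + (1 - (- x) ^ p - (1 - (- x)) ^ p))"
    using assms by (intro qcong_add qcong_truncated_log I_uminus) auto
  also have "\<dots> = 2 - (1 - x) ^ p - (1 + x) ^ p"
    using assms(1) by simp
  finally show ?thesis .
qed

end

section \<open>Exact transformation of the sum\<close>

text \<open>The factor \<open>n\<close> stays inside the sum on purpose: for n = p it lowers the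
  precision needed in a term to modulo p, except at 2j+1 = p, where it cancels the
  denominator.\<close>

lemma sum_central_trinomial:
  "(\<Sum>k<n. of_nat ((2 * k) choose k) / 12 ^ k * of_nat (central_trinomial k)) =
    2 * of_nat ((2 * n) choose n) / 4 ^ n * (\<Sum>j<n. of_nat n *
      (of_nat ((2 * j) choose j) * of_nat ((n - 1) choose j) * (- 1 / 3) ^ j / of_nat (2 * j + 1)) :: rat)"
proof -
  have "(\<Sum>k<n. of_nat ((2 * k) choose k) / 12 ^ k * of_nat (central_trinomial k)) =
    (\<Sum>k<n. \<Sum>j<n. of_nat ((2 * j) choose j) * (- 1 / 3) ^ j *
      (of_nat ((2 * k) choose k) * of_nat (k choose j) / 4 ^ k :: rat))"
  proof (rule sum.cong)
    fix k assume "k \<in> {..<n}"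
    then have k: "k < n" by simp
    \<comment> \<open>Vanishing binomials extend the range to j < n, independent of
      \<open>k\<close>, so that the sums can be exchanged.\<close>
    have "(of_nat (central_trinomial k) :: rat) =
      (\<Sum>j<n. of_nat (k choose j) * of_nat ((2 * j) choose j) * (-1) ^ j * 3 ^ (k - j))"
      unfolding central_trinomial_eq_sum using k
      by (intro sum.mono_neutral_left) (auto simp: binomial_eq_0)
    then have "of_nat ((2 * k) choose k) / 12 ^ k * (of_nat (central_trinomial k) :: rat) =
      (\<Sum>j<n. of_nat ((2 * k) choose k) / 12 ^ k *
        (of_nat (k choose j) * of_nat ((2 * j) choose j) * (-1) ^ j * 3 ^ (k - j)))"
      by (simp only: sum_distrib_left)
    also have "\<dots> = (\<Sum>j<n. of_nat ((2 * j) choose j) * (- 1 / 3) ^ j *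
      (of_nat ((2 * k) choose k) * of_nat (k choose j) / 4 ^ k))"
    proof (rule sum.cong)
      fix j
      show "of_nat ((2 * k) choose k) / 12 ^ k *
          (of_nat (k choose j) * of_nat ((2 * j) choose j) * (-1) ^ j * 3 ^ (k - j)) =
        of_nat ((2 * j) choose j) * (- 1 / 3) ^ j *
          (of_nat ((2 * k) choose k) * of_nat (k choose j) / 4 ^ k :: rat)"
      proof (cases "j \<le> k")
        case True
        have "(12::rat) ^ k = 4 ^ k * (3 ^ (k - j) * 3 ^ j)"
          using True by (simp flip: power_add power_mult_distrib)
        moreover have "(- 1 / 3 :: rat) ^ j = (-1) ^ j / 3 ^ j" by (rule power_divide)
        ultimately show ?thesis by (simp add: divide_simps)
      qed (simp add: binomial_eq_0)
    qed simp
    finally show "of_nat ((2 * k) choose k) / 12 ^ k * (of_nat (central_trinomial k) :: rat) =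
      (\<Sum>j<n. of_nat ((2 * j) choose j) * (- 1 / 3) ^ j *
      (of_nat ((2 * k) choose k) * of_nat (k choose j) / 4 ^ k))" .
  qed simp
  also have "\<dots> = (\<Sum>j<n. of_nat ((2 * j) choose j) * (- 1 / 3) ^ j *
      (\<Sum>k<n. of_nat ((2 * k) choose k) * of_nat (k choose j) / 4 ^ k))"
    by (subst sum.swap) (simp only: sum_distrib_left)
  also have "\<dots> = (\<Sum>j<n. 2 * of_nat ((2 * n) choose n) / 4 ^ n * (of_nat n *
      (of_nat ((2 * j) choose j) * of_nat ((n - 1) choose j) * (- 1 / 3) ^ j / of_nat (2 * j + 1))))"
  proof (rule sum.cong)
    fix j
    let ?s = "\<Sum>k<n. of_nat ((2 * k) choose k) * of_nat (k choose j) / 4 ^ k :: rat"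
    have "of_nat (2 * j + 1) * ?s =
        2 * (of_nat (Suc j) * of_nat (n choose Suc j)) * of_nat ((2 * n) choose n) / 4 ^ n"
      using sum_central_binomial_choose[of j n] by (simp add: mult.assoc add.commute)
    \<comment> \<open>Absorption produces the explicit factor \<open>n\<close>.\<close>
    also have "(of_nat (Suc j) :: rat) * of_nat (n choose Suc j) = of_nat n * of_nat ((n - 1) choose j)"
      using binomial_absorption[of j n] by (simp only: flip: of_nat_mult)
    finally have "?s = 2 * (of_nat n * of_nat ((n - 1) choose j)) * of_nat ((2 * n) choose n) / 4 ^ n / of_nat (2 * j + 1)"
      by (simp add: eq_divide_eq mult.commute add_eq_0_iff_both_eq_0 del: of_nat_Suc)
    then show "of_nat ((2 * j) choose j) * (- 1 / 3) ^ j * ?s =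
      2 * of_nat ((2 * n) choose n) / 4 ^ n * (of_nat n *
      (of_nat ((2 * j) choose j) * of_nat ((n - 1) choose j) * (- 1 / 3) ^ j / of_nat (2 * j + 1)))"
      by (simp only: times_divide_eq_right times_divide_eq_left mult_ac)
  qed simp
  finally show ?thesis by (simp only: sum_distrib_left)
qed

section \<open>The transformed sum modulo p^2\<close>

context prime_localization begin

text \<open>Euler's criterion gives 3^h as the Legendre symbol of 3 modulo p, and quadratic
  reciprocity absorbs the sign (-1)^h when the symbol is inverted.\<close>

lemma Legendre_3_qcong:
  assumes "p > 3" "p = 2 * h + 1"
  shows "qcong 1 ((-3) ^ h) (of_int (Legendre (int p) 3))"
proof -
  have h: "(int p - 1) div 2 = int h" "(p - 1) div 2 = h" using assms(2) by simp_all
  have "[Legendre 3 (int p) = 3 ^ h] (mod int p)"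
    using euler_criterion[of p 3] prime_p assms(1) unfolding h by simp
  then have "[(-1) ^ h * 3 ^ h = (-1) ^ h * Legendre 3 (int p)] (mod int p)"
    by (intro cong_scalar_left) (rule cong_sym)
  also have "(-1) ^ h * Legendre 3 (int p) = Legendre (int p) 3"
  proof -
    have "Legendre (int p) 3 * Legendre 3 (int p) = (-1) ^ h"
      using Quadratic_Reciprocity[of p 3, unfolded h] prime_p assms(1) by simp
    \<comment> \<open>The value 0 is excluded because the product of the two symbols is a power of
      -1; for the values 1 and -1 the square is 1.\<close>
    moreover have "Legendre 3 (int p) \<in> {0, 1, - 1}" by (simp add: Legendre_def)
    ultimately show ?thesis by auto
  qed
  finally have "[(-3) ^ h = Legendre (int p) 3] (mod int p)"
    by (simp flip: power_mult_distrib)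
  then show ?thesis using qcong_of_int[of "(-3) ^ h"] by simp
qed

text \<open>Modulo p the denominator 2j+1 becomes -2(h-j). Reversing the sum then gives the shape of
  \<open>sum_binomial_div_index\<close>.\<close>

lemma sum_below_middle_qcong:
  assumes "p > 3" "p = 2 * h + 1"
  shows "qcong 1
    (\<Sum>j<h. of_nat ((2 * j) choose j) * of_nat ((p - 1) choose j) * (- 1 / 3) ^ j / of_nat (2 * j + 1))
    (- 1 / 2 * (- 4 / 3) ^ h * ((\<Sum>k=1..h. (1 / 4) ^ k / of_nat k) - (\<Sum>k=1..h. 1 / of_nat k)))"
proof -
  have third: "(- 1 / 3) ^ j \<in> I 0" for j
    using I_inverse[OF coprime_less[of 3]] assms(1) I_uminus[of "1/3" 0] by (auto intro: I_power)
  have four: "(- 4) ^ j \<in> I 0" for j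
    using I_uminus[of 4 0] by (auto intro: I_power)
  have "qcong 1
    (\<Sum>j<h. of_nat ((2 * j) choose j) * of_nat ((p - 1) choose j) * (- 1 / 3) ^ j / of_nat (2 * j + 1))
    (\<Sum>j<h. ((-4) ^ j * of_nat (h choose j)) * (-1) ^ j * (- 1 / 3) ^ j * (- 1 / of_nat (2 * (h - j))))"
  proof (rule qcong_sum)
    fix j assume "j \<in> {..<h}"
    then have j: "j < h" by simp
    then have co: "coprime (2 * j + 1) p" "coprime (2 * (h - j)) p"
      using assms(2) by (intro coprime_less; simp)+
    \<comment> \<open>The two denominators 2j+1 and 2(h-j) add up to p.\<close>
    have inv: "qcong 1 (1 / of_nat (2 * j + 1)) (- 1 / of_nat (2 * (h - j)))"
    proof -
      have "1 / of_nat (2 * j + 1) - (- 1 / of_nat (2 * (h - j))) =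
          (of_nat (2 * (h - j)) + of_nat (2 * j + 1)) / (of_nat (2 * j + 1) * of_nat (2 * (h - j)) :: rat)"
        using j by (simp add: field_simps del: of_nat_Suc of_nat_mult of_nat_add of_nat_diff)
      also have "of_nat (2 * (h - j)) + of_nat (2 * j + 1) = (of_nat p :: rat)"
        unfolding of_nat_add[symmetric] using j assms(2) by simp
      also have "of_nat p / (of_nat (2 * j + 1) * of_nat (2 * (h - j))) \<in> I 1"
        unfolding of_nat_mult[symmetric] by (intro I_divide I_p coprime_mult_left_iff[THEN iffD2] conjI co)
      finally show ?thesis unfolding qcong_def .
    qed
    have num: "qcong 1 (of_nat ((2 * j) choose j) * of_nat ((p - 1) choose j) * (- 1 / 3) ^ j)
        (((-4) ^ j * of_nat (h choose j)) * (-1) ^ j * (- 1 / 3) ^ j)"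
      using j assms
      by (intro qcong_mult central_binomial_qcong[OF assms(2)] qcong_prime_choose I_mult qcong_refl
          I_of_nat third) linarith+
    have "qcong 1 (of_nat ((2 * j) choose j) * of_nat ((p - 1) choose j) * (- 1 / 3) ^ j * (1 / of_nat (2 * j + 1)))
        (((-4) ^ j * of_nat (h choose j)) * (-1) ^ j * (- 1 / 3) ^ j * (- 1 / of_nat (2 * (h - j))))"
      by (rule qcong_mult[OF num inv]) (intro I_mult I_of_nat third I_inverse co(1))+
    then show "qcong 1 (of_nat ((2 * j) choose j) * of_nat ((p - 1) choose j) * (- 1 / 3) ^ j / of_nat (2 * j + 1))
        (((-4) ^ j * of_nat (h choose j)) * (-1) ^ j * (- 1 / 3) ^ j * (- 1 / of_nat (2 * (h - j))))"
      by simp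
  qed
  also have "(\<Sum>j<h. ((-4) ^ j * of_nat (h choose j)) * (-1) ^ j * (- 1 / 3) ^ j * (- 1 / of_nat (2 * (h - j)))) =
      (\<Sum>i=1..h. - 1 / 2 * (- 4 / 3) ^ h * (of_nat (h choose i) * (- 3 / 4) ^ i / of_nat i) :: rat)"
  \<comment> \<open>With i = h - j the power (-4/3)^j equals (-4/3)^h (-3/4)^i, so the constant
    (-4/3)^h can be pulled out.\<close>
  proof (rule sum.reindex_bij_witness[of _ "\<lambda>i. h - i" "\<lambda>j. h - j"])
    fix j assume "j \<in> {..<h}"
    then have j: "j < h" by simp
    have "(- 4 / 3 :: rat) ^ h * (- 3 / 4) ^ (h - j) = (- 4 / 3) ^ j"
    proof -
      have "(- 4 / 3 :: rat) ^ h = (- 4 / 3) ^ j * (- 4 / 3) ^ (h - j)"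
        using j by (simp flip: power_add)
      then show ?thesis by (simp add: mult.assoc flip: power_mult_distrib)
    qed
    then have "- 1 / 2 * (- 4 / 3) ^ h * (of_nat (h choose (h - j)) * (- 3 / 4) ^ (h - j) / of_nat (h - j)) =
       - 1 / 2 * (of_nat (h choose j) * (- 4 / 3) ^ j / of_nat (h - j) :: rat)"
      using j binomial_symmetric[of j h] by (simp add: mult_ac)
    also have "(- 4 / 3 :: rat) ^ j = (-4) ^ j * (-1) ^ j * (- 1 / 3) ^ j"
      by (simp flip: power_mult_distrib)
    finally show "- 1 / 2 * (- 4 / 3) ^ h * (of_nat (h choose (h - j)) * (- 3 / 4) ^ (h - j) / of_nat (h - j)) =
      ((-4) ^ j * of_nat (h choose j)) * (-1) ^ j * (- 1 / 3) ^ j * (- 1 / of_nat (2 * (h - j)) :: rat)"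
      using j by (simp add: field_simps del: of_nat_diff)
  qed auto
  \<comment> \<open>Here x = -3/4, so 1 + x = 1/4 is the square of 1/2 and
    \<open>qcong_truncated_log_squares\<close> will apply.\<close>
  also have "\<dots> = - 1 / 2 * (- 4 / 3) ^ h * (\<Sum>k=1..h. ((1 + (- 3 / 4)) ^ k - 1) / of_nat k)"
    unfolding sum_binomial_div_index[symmetric] by (simp only: sum_distrib_left)
  also have "(\<Sum>k=1..h. ((1 + (- 3 / 4)) ^ k - 1) / of_nat k :: rat) =
      (\<Sum>k=1..h. (1 / 4) ^ k / of_nat k) - (\<Sum>k=1..h. 1 / of_nat k)"
    by (simp add: diff_divide_distrib sum_subtractf)
  finally show ?thesis .
qed

text \<open>The prime p divides (2j)! but not j!, so it survives in the quotient.\<close>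

lemma prime_dvd_central_binomial:
  assumes "j < p" "p \<le> 2 * j"
  shows "p dvd ((2 * j) choose j)"
proof -
  have "fact j * fact j * ((2 * j) choose j) = (fact (2 * j) :: nat)"
    using binomial_fact_lemma[of j "2 * j"] by simp
  moreover have "p dvd fact (2 * j)" "\<not> p dvd fact j"
    using assms prime_p by (simp_all add: prime_dvd_fact_iff)
  ultimately show ?thesis using prime_p by (metis prime_dvd_mult_iff)
qed

text \<open>Each binomial (2j over j) contains p, while 2j+1 lies strictly between p and 2p and so
  cannot cancel it.\<close>

lemma sum_above_middle:
  assumes "p > 3" "p = 2 * h + 1"
  shows "(\<Sum>j\<in>{h<..<p}. of_nat ((2 * j) choose j) * of_nat ((p - 1) choose j) * (- 1 / 3) ^ j / of_nat (2 * j + 1)) \<in> I 1"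
proof (rule I_sum)
  fix j assume "j \<in> {h<..<p}"
  then have j: "h < j" "j < p" by auto
  have third: "(- 1 / 3) ^ j \<in> I 0" for j
    using I_inverse[OF coprime_less[of 3]] assms(1) I_uminus[of "1/3" 0] by (auto intro: I_power)
  have "\<not> p dvd 2 * j + 1"
  proof
    assume "p dvd 2 * j + 1"
    then obtain c where c: "2 * j + 1 = p * c" by (elim dvdE)
    have "p * 1 < p * c" "p * c < p * 2" unfolding c[symmetric] using j assms by auto
    then show False by simp
  qed
  then have co: "coprime (2 * j + 1) p"
    using prime_p by (metis coprime_commute prime_imp_coprime)
  show "of_nat ((2 * j) choose j) * of_nat ((p - 1) choose j) * (- 1 / 3) ^ j / of_nat (2 * j + 1) \<in> I 1"
    by (rule I_divide[OF I_mult_right[OF I_mult_right[OF I_of_nat_dvd[OF prime_dvd_central_binomial] I_of_nat] third] co])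
       (use j assms in auto)
qed

lemma coprime_4:
  assumes "p > 3"
  shows "coprime 4 p"
proof -
  have "coprime 2 p" using assms by (intro coprime_less) auto
  then have "coprime (2 ^ 2) p" by (simp only: coprime_power_left_iff simp_thms)
  moreover have "(4::nat) = 2 ^ 2" by simp
  ultimately show ?thesis by (simp only:)
qed

lemma central_trinomial_sum_qcong:
  assumes "p > 3" "p = 2 * h + 1"
  shows "qcong 2 (\<Sum>j<p. of_nat p *
      (of_nat ((2 * j) choose j) * of_nat ((p - 1) choose j) * (- 1 / 3) ^ j / of_nat (2 * j + 1)))
    ((- 1 / 3) ^ h * ((2 ^ p - 1) ^ 2 - 4 ^ h / 2 * (2 ^ p - (1 / 2) ^ p - (3 / 2) ^ p)))"
    (is "qcong 2 (\<Sum>j<p. of_nat p * ?t j) _")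
proof -
  have third: "(- 1 / 3) ^ j \<in> I 0" for j
    using I_inverse[OF coprime_less[of 3]] assms(1) I_uminus[of "1/3" 0] by (auto intro: I_power)
  have half: "1 / 2 \<in> I 0"
    using I_inverse[OF coprime_less[of 2]] assms(1) by simp
  have "{..<p} = {..<h} \<union> ({h} \<union> {h<..<p})" using assms(2) by auto
  then have "sum f {..<p} = sum f {..<h} + (f h + sum f {h<..<p})" for f :: "nat \<Rightarrow> rat"
    by (simp add: sum.union_disjoint disjoint_iff)
  then have "(\<Sum>j<p. of_nat p * ?t j) =
      of_nat p * sum ?t {..<h} + (of_nat p * ?t h + of_nat p * sum ?t {h<..<p})"
    by (simp only: sum_distrib_left)
  also have "qcong 2 \<dots> (- 1 / 2 * (- 4 / 3) ^ h * (2 ^ p - (1 / 2) ^ p - (3 / 2) ^ p)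
      + ((2 ^ p - 1) ^ 2 * (- 1 / 3) ^ h + 0))"
  proof (intro qcong_add)
    let ?g = "\<Sum>k=1..h. (1 / 4) ^ k / of_nat k :: rat" and ?h = "\<Sum>k=1..h. 1 / of_nat k :: rat"
    \<comment> \<open>The truncated logarithm at x = 1/2.\<close>
    have g: "qcong 2 (of_nat p * ?g) (2 - (1 / 2) ^ p - (3 / 2) ^ p)"
      using qcong_truncated_log_squares[OF assms(2) half] by (simp add: power2_eq_square)
    \<comment> \<open>At x = 1 the term (1-x)^p vanishes; this is the harmonic number up to h, used
      again for the middle binomial in \<open>ch\<close>.\<close>
    have h: "qcong 2 (of_nat p * ?h) (2 - 2 ^ p)"
      using qcong_truncated_log_squares[OF assms(2) I_numeral(2)] assms(1) by (simp add: power_0_left)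
    have "qcong (Suc 1) (of_nat p * sum ?t {..<h}) (of_nat p * (- 1 / 2 * (- 4 / 3) ^ h * (?g - ?h)))"
      by (intro qcong_p_mult sum_below_middle_qcong assms)
    then have "qcong 2 (of_nat p * sum ?t {..<h}) (- 1 / 2 * (- 4 / 3) ^ h * (of_nat p * ?g - of_nat p * ?h))"
      by (simp only: numeral_2_eq_2 One_nat_def right_diff_distrib mult.left_commute)
    also have "qcong 2 \<dots> (- 1 / 2 * (- 4 / 3) ^ h * (2 - (1 / 2) ^ p - (3 / 2) ^ p - (2 - 2 ^ p)))"
    proof (intro qcong_scale qcong_diff g h)
      have "(- 4 / 3 :: rat) ^ h = 4 ^ h * (- 1 / 3) ^ h"
        by (simp flip: power_mult_distrib)
      then have "(- 4 / 3) ^ h \<in> I 0" using third by (simp add: I_mult I_power)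
      then show "- 1 / 2 * (- 4 / 3) ^ h \<in> I 0"
        using I_mult[OF I_uminus[OF half]] by simp
    qed
    finally show "qcong 2 (of_nat p * sum ?t {..<h}) (- 1 / 2 * (- 4 / 3) ^ h * (2 ^ p - (1 / 2) ^ p - (3 / 2) ^ p))"
      by (simp add: algebra_simps)
    have ch: "qcong 2 (of_nat ((p - 1) choose h)) ((-1) ^ h * (2 ^ p - 1))"
    proof -
      have "qcong 2 (of_nat ((p - 1) choose h)) ((-1) ^ h * (1 - of_nat p * ?h))"
        using assms by (intro qcong_prime_choose_2) simp
      also have "qcong 2 \<dots> ((-1) ^ h * (1 - (2 - 2 ^ p)))"
        using I_uminus[of 1 0] by (intro qcong_scale qcong_diff h I_power qcong_refl) simp
      finally show ?thesis by (simp add: algebra_simps)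
    qed
    \<comment> \<open>Since 2h = p-1 and 2h+1 = p, the two binomials coincide and p cancels. No
      factor p is left over, hence the need for \<open>ch\<close> modulo p^2.\<close>
    have "of_nat p * ?t h = of_nat ((p - 1) choose h) * of_nat ((p - 1) choose h) * (- 1 / 3) ^ h"
      using assms(2) by (simp add: divide_simps)
    also have "qcong 2 \<dots> ((-1) ^ h * (2 ^ p - 1) * ((-1) ^ h * (2 ^ p - 1)) * (- 1 / 3) ^ h)"
      by (intro qcong_mult ch qcong_refl I_of_nat I_mult third)
    also have "(-1) ^ h * (2 ^ p - 1) * ((-1) ^ h * (2 ^ p - 1)) = ((2 ^ p - 1) ^ 2 :: rat)"
    proof -
      have "(-1) ^ h * (2 ^ p - 1) * ((-1) ^ h * (2 ^ p - 1)) =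
          ((-1) ^ h * (-1) ^ h * (2 ^ p - 1) ^ 2 :: rat)"
        by (simp only: power2_eq_square mult_ac)
      also have "(-1) ^ h * (-1) ^ h = (1 :: rat)" by (simp flip: power_mult_distrib)
      finally show ?thesis by simp
    qed
    finally show "qcong 2 (of_nat p * ?t h) ((2 ^ p - 1) ^ 2 * (- 1 / 3) ^ h)" .
    show "qcong 2 (of_nat p * sum ?t {h<..<p}) 0"
      using I_p_mult[OF sum_above_middle[OF assms]] by (simp add: qcong_def numeral_2_eq_2)
  qed
  also have "- 1 / 2 * (- 4 / 3) ^ h * (2 ^ p - (1 / 2) ^ p - (3 / 2) ^ p)
      + ((2 ^ p - 1) ^ 2 * (- 1 / 3) ^ h + 0) =
    ((- 1 / 3) ^ h * ((2 ^ p - 1) ^ 2 - 4 ^ h / 2 * (2 ^ p - (1 / 2) ^ p - (3 / 2) ^ p)) :: rat)"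
  proof -
    have "(- 4 / 3 :: rat) ^ h = 4 ^ h * (- 1 / 3) ^ h"
      by (simp flip: power_mult_distrib)
    then show ?thesis by (simp only:) (simp add: algebra_simps)
  qed
  finally show ?thesis .
qed

section \<open>Fermat quotients and the final congruence\<close>

lemma fermat_quotient_multiple: "coprime b p \<Longrightarrow> of_nat b ^ (p - 1) - 1 \<in> I 1"
proof -
  assume "coprime b p"
  then have "\<not> p dvd b" using prime_p by (auto simp: coprime_absorb_right)
  then have "[b ^ (p - 1) = 1] (mod p)" by (rule fermat_theorem[OF prime_p])
  then have "[int (b ^ (p - 1)) = int 1] (mod int p)" by (simp only: cong_int_iff)
  from qcong_of_int[OF this] show ?thesis by (simp add: qcong_def)
qed

text \<open>One Newton step for a square root: e = (-3)^h satisfies e^2 = 3^(p-1) and is congruent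
  modulo p to l, where l^2 = 1. Hence e and l(1 + (e^2-1)/2) differ by l(e-l)^2/2, which is a
  multiple of p^2.\<close>

lemma minus_three_power_qcong:
  assumes "p > 3" "p = 2 * h + 1"
  shows "qcong 2 ((-3) ^ h) (of_int (Legendre (int p) 3) * (1 + (3 ^ (p - 1) - 1) / 2))"
proof -
  define e :: rat where "e = (-3) ^ h"
  define l :: rat where "l = of_int (Legendre (int p) 3)"
  have "\<not> [int p = 0] (mod 3)"
  proof
    assume "[int p = 0] (mod 3)"
    then have "int 3 dvd int p" by (simp add: cong_0_iff)
    then have "3 dvd p" by (simp only: int_dvd_int_iff)
    then show False using prime_p assms(1) by (metis One_nat_def numeral_eq_one_iff less_irrefl num.distinct(3) prime_nat_iff)
  qed
  then have l2: "l * l = 1" by (simp add: l_def Legendre_def)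
  have d: "e - l \<in> I 1"
    using Legendre_3_qcong[OF assms] by (simp add: qcong_def e_def l_def)
  have "3 ^ (p - 1) = e * e"
    by (simp add: e_def assms(2) power_mult flip: power_mult_distrib)
  then have "e - l * (1 + (3 ^ (p - 1) - 1) / 2) = (e - l) - l * (e * e - l * l) / 2"
    by (simp add: l2 algebra_simps)
  also have "\<dots> = (e - l) - l * ((e - l) * (e - l) + 2 * l * (e - l)) / 2"
    by (simp add: algebra_simps)
  also have "\<dots> = (e - l) - (l * l) * (e - l) - l * ((e - l) * (e - l)) / 2"
    by (simp add: field_simps)
  also have "\<dots> = - (l * ((e - l) * (e - l)) / of_nat 2)"
    by (simp add: l2)
  also have "\<dots> \<in> I 2"
    using assms(1) d by (intro I_uminus I_divide I_mult I_mult_1 coprime_less) (auto simp: l_def)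
  finally show ?thesis by (simp add: qcong_def e_def l_def)
qed

text \<open>All quantities are expressed through \<open>a\<close> and \<open>b\<close>, which are p
  times the Fermat quotients of 2 and 3, and through \<open>e\<close>. To first order
  \<open>m\<close> contributes 1 + 2a + 3b/4, the prefactor 1 - 2a, and e/(1+b) contributes l(1 -
  b/2); so \<open>a\<close> drops out and l(1 + b/4) remains.\<close>

lemma sum_central_trinomial_qcong:
  assumes "p > 3"
  shows "qcong 2 (\<Sum>k<p. of_nat ((2 * k) choose k) / 12 ^ k * of_nat (central_trinomial k))
    (of_int (Legendre (int p) 3) * ((3 ^ (p - 1) + 3) / 4))"
proof -
  have "odd p" using prime_odd_nat[OF prime_p] assms by simp
  then obtain h where h: "p = 2 * h + 1" by (elim oddE)
  have co: "coprime 2 p" "coprime 3 p" using coprime_less[of 2] coprime_less[of 3] assms by auto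
  define a b e l :: rat
    where "a = 2 ^ (p - 1) - 1" and "b = 3 ^ (p - 1) - 1" and "e = (-3) ^ h"
      and "l = of_int (Legendre (int p) 3)"
  have a: "a \<in> I 1" and b: "b \<in> I 1"
    using fermat_quotient_multiple[OF co(1)] fermat_quotient_multiple[OF co(2)]
    by (simp_all add: a_def b_def)
  then have ab0: "a \<in> I 0" "b \<in> I 0" by (auto intro: I_mono)
  have l0: "l \<in> I 0" by (simp add: l_def)
  define r where "r = e - l * (1 + b / 2)"
  have r: "r \<in> I 2"
    using minus_three_power_qcong[OF assms h] by (simp add: qcong_def r_def e_def l_def b_def)
  have nz: "1 + a \<noteq> 0" "1 + b \<noteq> 0" by (simp_all add: a_def b_def)
  have two: "2 ^ p = 2 * (1 + a)" and three: "3 ^ p = 3 * (1 + b)" and four: "4 ^ h = 1 + a"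
    by (simp_all add: a_def b_def h power_mult)
  \<comment> \<open>This is (-3)^h / 9^h, where 9^h = 3^(p-1).\<close>
  have third: "(- 1 / 3) ^ h = e / (1 + b)"
  proof -
    have "(- 1 / 3 :: rat) ^ h * 9 ^ h = e" by (simp add: e_def flip: power_mult_distrib)
    moreover have "9 ^ h = 1 + b" by (simp add: b_def h power_mult)
    ultimately show ?thesis using nz by (simp add: field_simps)
  qed
  \<comment> \<open>The bracket of \<open>central_trinomial_sum_qcong\<close>, written exactly:
    (1+2a)^2 - (1+a)^2 + 1 + 3b/4.\<close>
  define m where "m = 1 + 2 * a + 3 * a ^ 2 + 3 / 4 * b"
  have m: "(2 ^ p - 1) ^ 2 - 4 ^ h / 2 * (2 ^ p - (1 / 2) ^ p - (3 / 2) ^ p) = m"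
  proof -
    have halves: "(1 / 2) ^ p = 1 / (2 * (1 + a))" "(3 / 2) ^ p = 3 * (1 + b) / (2 * (1 + a))"
      by (simp_all only: power_divide two three power_one)
    have cancel: "u / 2 * (2 * u - 1 / (2 * u) - 3 * (1 + b) / (2 * u)) = u ^ 2 - (4 + 3 * b) / 4"
      if "u \<noteq> 0" for u
      using that by (simp add: field_simps power2_eq_square)
    have "(2 ^ p - 1) ^ 2 - 4 ^ h / 2 * (2 ^ p - (1 / 2) ^ p - (3 / 2) ^ p) =
        (2 * (1 + a) - 1) ^ 2 - (1 + a) / 2 * (2 * (1 + a) - 1 / (2 * (1 + a)) - 3 * (1 + b) / (2 * (1 + a)))"
      by (simp only: halves two four)
    also have "\<dots> = m"
      unfolding cancel[OF nz(1)] m_def by (simp add: field_simps power2_eq_square)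
    finally show ?thesis .
  qed
  let ?S = "\<Sum>k<p. of_nat ((2 * k) choose k) / 12 ^ k * of_nat (central_trinomial k) :: rat"
  have F: "qcong 2 (2 * of_nat ((2 * p) choose p) / 4 ^ p) (1 / (1 + a) ^ 2)"
  proof -
    have "(4::rat) ^ p = (2 ^ p) ^ 2"
      by (simp add: power2_eq_square flip: power_mult_distrib)
    then have "(4::rat) ^ p = 4 * (1 + a) ^ 2"
      unfolding two by (simp add: power2_eq_square algebra_simps)
    then have "2 * of_nat ((2 * p) choose p) / 4 ^ p = of_nat ((2 * p) choose p) / (2 * (1 + a) ^ 2)"
      by simp
    also have "\<dots> = of_nat ((2 * p) choose p) / of_nat (2 * (2 ^ (p - 1)) ^ 2)"
      by (simp add: a_def)
    also have "qcong 2 \<dots> (2 / of_nat (2 * (2 ^ (p - 1)) ^ 2))"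
      using co by (intro qcong_divide central_binomial_prime) simp
    also have "2 / of_nat (2 * (2 ^ (p - 1)) ^ 2) = 1 / (1 + a) ^ 2"
      by (simp add: a_def)
    finally show ?thesis .
  qed
  have "?S = 2 * of_nat ((2 * p) choose p) / 4 ^ p * (\<Sum>j<p. of_nat p *
      (of_nat ((2 * j) choose j) * of_nat ((p - 1) choose j) * (- 1 / 3) ^ j / of_nat (2 * j + 1)))"
    by (rule sum_central_trinomial)
  also have "qcong 2 \<dots> (1 / (1 + a) ^ 2 * (e / (1 + b) * m))"
  proof (rule qcong_mult[OF F])
    show q: "qcong 2 (\<Sum>j<p. of_nat p *
      (of_nat ((2 * j) choose j) * of_nat ((p - 1) choose j) * (- 1 / 3) ^ j / of_nat (2 * j + 1))) (e / (1 + b) * m)"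
      using central_trinomial_sum_qcong[OF assms h] unfolding m third .
    \<comment> \<open>Integrality is checked on the simplified sides, whose denominators are visibly
      prime to p, and carried back along the congruences.\<close>
    have "1 / (1 + a) ^ 2 = 1 / of_nat ((2 ^ (p - 1)) ^ 2)" by (simp add: a_def)
    also have "\<dots> \<in> I 0" using co by (intro I_inverse) simp
    finally show "2 * of_nat ((2 * p) choose p) / 4 ^ p \<in> I 0"
      by (rule qcong_integral[OF qcong_sym[OF F]])
    have "e / (1 + b) * m = e * (1 + 2 * a + 3 * a ^ 2 + 3 * b / of_nat 4) / of_nat (3 ^ (p - 1))"
      by (simp add: b_def m_def)
    also have "\<dots> \<in> I 0"
      using co ab0 by (intro I_divide I_mult I_add I_power coprime_4 assms) (auto simp: e_def intro: I_power)
    finally show "(\<Sum>j<p. of_nat p *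
      (of_nat ((2 * j) choose j) * of_nat ((p - 1) choose j) * (- 1 / 3) ^ j / of_nat (2 * j + 1))) \<in> I 0"
      by (rule qcong_integral[OF qcong_sym[OF q]])
  qed
  also have "qcong 2 (1 / (1 + a) ^ 2 * (e / (1 + b) * m)) (l * (1 + b / 4))"
  proof (rule qcong_mult_cancel)
    \<comment> \<open>This is (1+a)^2 (1+b), a natural number prime to p that clears the
      denominators.\<close>
    let ?c = "(2 ^ (p - 1)) ^ 2 * 3 ^ (p - 1) :: nat"
    show "coprime ?c p" using co by simp
    have c: "of_nat ?c = (1 + a) ^ 2 * (1 + b)" by (simp add: a_def b_def)
    have "of_nat ?c * (1 / (1 + a) ^ 2 * (e / (1 + b) * m)) = e * m"
    proof -
      have "u * v * (1 / u * (e / v * m)) = e * m" if "u \<noteq> 0" "v \<noteq> 0" for u v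
        using that by simp
      then show ?thesis unfolding c using nz by simp
    qed
    \<comment> \<open>The exact difference: every term contains \<open>r\<close> or a product of two
      factors from \<open>a\<close> and \<open>b\<close>, hence lies in \<open>I 2\<close>. All
      linear terms have cancelled.\<close>
    moreover have "e * m - (1 + a) ^ 2 * (1 + b) * (l * (1 + b / 4)) =
        r * m + l * (a * a * (2 + b / 4) - a * b * (3 / 2) + b * b * (3 / 8 - (1 + a) ^ 2 / 4))"
      by (simp add: r_def m_def field_simps power2_eq_square)
    moreover have "r * m + l * (a * a * (2 + b / 4) - a * b * (3 / 2) + b * b * (3 / 8 - (1 + a) ^ 2 / 4)) \<in> I 2"
    proof -
      have half: "x / 2 \<in> I 0" if "x \<in> I 0" for x
        using I_divide[OF that co(1)] by simp
      have frac: "x / 2 \<in> I 0" "x / 4 \<in> I 0" "x / 8 \<in> I 0" if "x \<in> I 0" for x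
        using half[OF that] half[OF half[OF that]] half[OF half[OF half[OF that]]] by simp_all
      have "m \<in> I 0" unfolding m_def using ab0 frac(2)[of 3] by (intro I_add I_mult I_power) auto
      then show ?thesis
        using r a b ab0 l0
        by (intro I_add I_diff I_mult[OF l0] I_mult_right[OF r] I_mult_right[OF I_mult_1] frac I_power) auto
    qed
    ultimately show "qcong 2 (of_nat ?c * (1 / (1 + a) ^ 2 * (e / (1 + b) * m))) (of_nat ?c * (l * (1 + b / 4)))"
      unfolding qcong_def c by simp
  qed
  also have "l * (1 + b / 4) = of_int (Legendre (int p) 3) * ((3 ^ (p - 1) + 3) / 4)"
    by (simp add: l_def b_def field_simps)
  finally show ?thesis .
qed

text \<open>The integrality of \<open>x\<close> demanded by \<open>rat_cong_sq\<close> follows from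
  that of \<open>y\<close> and of the difference; division by p^2 moves \<open>I 2\<close> to
  \<open>I 0\<close>.\<close>

lemma rat_cong_sq_iff:
  assumes "y \<in> I 0"
  shows "rat_cong_sq p x y \<longleftrightarrow> qcong 2 x y"
proof -
  have p: "(of_nat p :: rat) \<noteq> 0" using prime_p by (simp add: prime_gt_0_nat)
  have "x - y \<in> I 2" if "(x - y) / of_nat (p ^ 2) \<in> I 0"
  proof -
    have "of_nat p * of_nat p * ((x - y) / of_nat (p ^ 2)) \<in> I 2"
      by (rule I_mult_right[OF I_mult_1[OF I_p I_p] that])
    then show ?thesis using p by (simp add: power2_eq_square)
  qed
  moreover have "(x - y) / of_nat (p ^ 2) \<in> I 0" if "x - y \<in> I 2"
    using that p by (auto elim!: I_E intro!: I_I)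
  moreover have "x \<in> I 0" if "x - y \<in> I 2"
    using that assms by (metis qcong_def qcong_integral qcong_sym)
  ultimately show ?thesis
    using assms unfolding rat_cong_sq_def p_integral_iff qcong_def by blast
qed

end

theorem theorem1p1:
  fixes p :: nat
  assumes "prime p" and "p > 3"
  shows "rat_cong_sq p
    (\<Sum>k = 0..p - 1. of_nat ((2 * k) choose k) / 12 ^ k * of_nat (central_trinomial k))
    (of_int (Legendre (int p) 3) * ((3 ^ (p - 1) + 3) / 4))"
proof -
  interpret prime_localization p by unfold_locales (rule assms(1))
  have "{0..p - 1} = {..<p}" using assms(2) by auto
  moreover have "of_int (Legendre (int p) 3) * ((3 ^ (p - 1) + 3) / of_nat 4) \<in> p_multiples p 0"
    by (intro I_mult I_divide I_add I_power I_of_int coprime_4 assms(2)) simp_all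
  ultimately show ?thesis
    using sum_central_trinomial_qcong[OF assms(2)] by (simp add: rat_cong_sq_iff)
qed

end
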